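(* For every $p\in[0,1]$, the weak metric space $(\mathcal{T}(T^2),\delta_p)$ (with $\mathcal{T}(T^2)$ identified with $\mathbb{H}$) is a weak Finsler metric space with associated weak norms $$\|v\|_{\delta_p}=\frac{|v|+(1-p)\,\mathrm{Im}(v)}{2\,\mathrm{Im}(\zeta)}\qquad(\zeta\in\mathbb{H},\ v\in T_\zeta\mathbb{H}\cong\mathbb{C}),$$ and for all $\zeta_1,\zeta_2\in\mathbb{H}$ the hyperbolic geodesic from $\zeta_1$ to $\zeta_2$ is the unique geodesic (up to reparametrisation) for $\delta_p$ from $\zeta_1$ to $\zeta_2$. Moreover, $\{\delta_p\}_{0\le p\le1}$ is a continuous family (for all $\zeta_1,\zeta_2\in\mathbb{H}$ the map $p\mapsto\delta_p(\zeta_1,\zeta_2)$ is continuous) which deforms $\delta_0=\delta$ to $\delta_1=d_{hyp}$.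
   Context: $\mathbb{H}=\{z\in\mathbb{C}\mid \mathrm{Im}(z)>0\}$, and $d_{hyp}$ is the hyperbolic distance on $\mathbb{H}$ of constant curvature $-4$ (length element $\sqrt{dx^2+dy^2}/(2y)$), which coincides with the Teichmüller metric. The Teichmüller space $\mathcal{T}(T^2)$ of the torus is identified with $\mathbb{H}$ by associating to $\zeta\in\mathbb{H}$ the marked torus $\mathbb{C}/(\mathbb{Z}+\zeta\mathbb{Z})$ whose marking sends fixed generators $a,b$ of $\pi_1(T^2)$ to $1,\zeta$. Define the weak metric $\delta(\zeta_1,\zeta_2)=\log\sup_{x\in\mathbb{R}}\left|\frac{\zeta_2-x}{\zeta_1-x}\right|$ and, for $0\le p\le1$, $$\delta_p(\zeta_1,\zeta_2)=\log\sup_{x\in\mathbb{R}}\frac{(\mathrm{Im}\,\zeta_1)^{p/2}}{(\mathrm{Im}\,\zeta_2)^{p/2}}\left|\frac{\zeta_2-x}{\zeta_1-x}\right| .$$ A weak metric is a nonnegative function on pairs of points, zero on the diagonal, satisfying the triangle inequality (not necessarily symmetric or separating). A weak norm on a finite-dimensional real vector space $V$ is a map $V\to[0,\infty)$ with $\|0\|=0$ and $\|v+v'\|\le\|v\|+\|v'\|$. A weak metric on a smooth manifold is weak Finsler if the manifold carries a continuous field of weak norms on its tangent spaces such that the distance from one point to another equals the infimum, over piecewise $C^1$ paths from the first to the second, of the integral of the weak norm of the tangent vector. A geodesic for a weak metric $d$ is a continuous path $\gamma$ such that $d(\zeta,\zeta'')=d(\zeta,\zeta')+d(\zeta',\zeta'')$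 whenever $\zeta,\zeta',\zeta''$ lie on $\gamma$ in this order; the hyperbolic geodesic from $\zeta_1$ to $\zeta_2$ is the oriented $d_{hyp}$-geodesic segment. *)

theory Defs
  imports "HOL-Analysis.Analysis"
begin

definition upper_half_plane :: "complex set" where
  "upper_half_plane = {z. Im z > 0}"

definition weak_metric_on :: "'a set \<Rightarrow> ('a \<Rightarrow> 'a \<Rightarrow> real) \<Rightarrow> bool" where
  "weak_metric_on M d \<longleftrightarrow>
     (\<forall>x\<in>M. \<forall>y\<in>M. d x y \<ge> 0) \<and>
     (\<forall>x\<in>M. d x x = 0) \<and>
     (\<forall>x\<in>M. \<forall>y\<in>M. \<forall>z\<in>M. d x z \<le> d x y + d y z)"

definition weak_norm :: "('v::real_vector \<Rightarrow> real) \<Rightarrow> bool" where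
  "weak_norm N \<longleftrightarrow> (\<forall>v. N v \<ge> 0) \<and> N 0 = 0 \<and> (\<forall>v w. N (v + w) \<le> N v + N w)"

text \<open>
  The library's \<^const>\<open>piecewise_C1_differentiable_on\<close> imposes no condition on the derivative
  near the finitely many exceptional points, so it admits paths of infinite length, for which the
  Henstock-Kurzweil integral of the speed would be the default value 0. Here \<^term>\<open>g\<close> is
  required to be C1 on each closed piece of a partition of the unit interval, with one-sided
  derivatives at the partition points.
\<close>

definition piecewise_C1_path :: "(real \<Rightarrow> 'a::real_normed_vector) \<Rightarrow> bool" where
  "piecewise_C1_path g \<longleftrightarrow>
     (\<exists>(n::nat) (a :: nat \<Rightarrow> real).
        a 0 = 0 \<and> a n = 1 \<and> (\<forall>i<n. a i < a (Suc i)) \<and>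
        (\<forall>i<n. \<exists>D. continuous_on {a i..a (Suc i)} D \<and>
           (\<forall>t\<in>{a i..a (Suc i)}.
              (g has_vector_derivative D t) (at t within {a i..a (Suc i)}))))"

definition piecewise_C1_paths ::
  "'a::real_normed_vector set \<Rightarrow> 'a \<Rightarrow> 'a \<Rightarrow> (real \<Rightarrow> 'a) set" where
  "piecewise_C1_paths M x y =
     {g. piecewise_C1_path g \<and> path_image g \<subseteq> M \<and> pathstart g = x \<and> pathfinish g = y}"

text \<open>
  \<^term>\<open>N x v\<close> is the weak norm of the tangent vector \<^term>\<open>v\<close> at the point \<^term>\<open>x\<close>.
  The value of \<^const>\<open>vector_derivative\<close> at the endpoints and at the breakpoints is immaterial,
  these being finite in number.
\<close>

definition finsler_length ::
  "('a::real_normed_vector \<Rightarrow> 'a \<Rightarrow> real) \<Rightarrow> (real \<Rightarrow> 'a) \<Rightarrow> real" where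
  "finsler_length N g = integral {0..1} (\<lambda>t. N (g t) (vector_derivative g (at t)))"

text \<open>
  The manifold is an open connected subset \<^term>\<open>M\<close> of a Euclidean space, with every
  tangent space identified with the ambient space; connectedness ensures that the infimum is
  taken over a nonempty set.
\<close>

definition weak_finsler_metric_on ::
  "'a::euclidean_space set \<Rightarrow> ('a \<Rightarrow> 'a \<Rightarrow> real) \<Rightarrow> ('a \<Rightarrow> 'a \<Rightarrow> real) \<Rightarrow> bool" where
  "weak_finsler_metric_on M d N \<longleftrightarrow>
     open M \<and> connected M \<and> weak_metric_on M d \<and>
     (\<forall>x\<in>M. weak_norm (N x)) \<and>
     continuous_on (M \<times> UNIV) (\<lambda>(x, v). N x v) \<and>
     (\<forall>x\<in>M. \<forall>y\<in>M. d x y = (INF g\<in>piecewise_C1_paths M x y. finsler_length N g))"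

definition weak_geodesic ::
  "'a::topological_space set \<Rightarrow> ('a \<Rightarrow> 'a \<Rightarrow> real) \<Rightarrow> 'a \<Rightarrow> 'a \<Rightarrow> (real \<Rightarrow> 'a) \<Rightarrow> bool" where
  "weak_geodesic M d x y g \<longleftrightarrow>
     path g \<and> path_image g \<subseteq> M \<and> pathstart g = x \<and> pathfinish g = y \<and>
     (\<forall>r s t. 0 \<le> r \<and> r \<le> s \<and> s \<le> t \<and> t \<le> 1 \<longrightarrow>
        d (g r) (g t) = d (g r) (g s) + d (g s) (g t))"

text \<open>
  A reparametrisation is only weakly increasing: a geodesic in the above sense may stay
  at a point for some time.
\<close>

definition reparametrisation_of :: "(real \<Rightarrow> 'a) \<Rightarrow> (real \<Rightarrow> 'a) \<Rightarrow> bool" where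
  "reparametrisation_of g c \<longleftrightarrow>
     (\<exists>\<phi> :: real \<Rightarrow> real. continuous_on {0..1} \<phi> \<and> mono_on {0..1} \<phi> \<and> \<phi> 0 = 0 \<and> \<phi> 1 = 1 \<and>
        (\<forall>t\<in>{0..1}. c t = g (\<phi> t)))"

definition unique_weak_geodesic ::
  "'a::topological_space set \<Rightarrow> ('a \<Rightarrow> 'a \<Rightarrow> real) \<Rightarrow> 'a \<Rightarrow> 'a \<Rightarrow> (real \<Rightarrow> 'a) \<Rightarrow> bool" where
  "unique_weak_geodesic M d x y g \<longleftrightarrow>
     weak_geodesic M d x y g \<and> (\<forall>c. weak_geodesic M d x y c \<longrightarrow> reparametrisation_of g c)"

text \<open>The length element is half of the curvature -1 one, which gives curvature -4.\<close>

definition hyp_dist :: "complex \<Rightarrow> complex \<Rightarrow> real" where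
  "hyp_dist z w =
     (INF g\<in>piecewise_C1_paths upper_half_plane z w.
        finsler_length (\<lambda>\<zeta> v. sqrt ((Re v)\<^sup>2 + (Im v)\<^sup>2) / (2 * Im \<zeta>)) g)"

text \<open>The oriented geodesic segment, parametrised proportionally to arc length.\<close>

definition hyperbolic_geodesic :: "complex \<Rightarrow> complex \<Rightarrow> (real \<Rightarrow> complex) \<Rightarrow> bool" where
  "hyperbolic_geodesic z w g \<longleftrightarrow>
     path g \<and> path_image g \<subseteq> upper_half_plane \<and> pathstart g = z \<and> pathfinish g = w \<and>
     (\<forall>s\<in>{0..1}. \<forall>t\<in>{0..1}. hyp_dist (g s) (g t) = \<bar>s - t\<bar> * hyp_dist z w)"

text \<open>
  Teichmueller space is identified with the upper half-plane: \<^term>\<open>\<zeta>\<close> corresponds to the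
  quotient of the plane by the lattice spanned by 1 and \<^term>\<open>\<zeta>\<close>, with the marking sending
  the two fixed generators of the fundamental group to 1 and \<^term>\<open>\<zeta>\<close>.
\<close>

definition delta :: "complex \<Rightarrow> complex \<Rightarrow> real" where
  "delta \<zeta>1 \<zeta>2 = ln (SUP x::real. cmod ((\<zeta>2 - of_real x) / (\<zeta>1 - of_real x)))"

definition delta_p :: "real \<Rightarrow> complex \<Rightarrow> complex \<Rightarrow> real" where
  "delta_p p \<zeta>1 \<zeta>2 =
     ln (SUP x::real. (Im \<zeta>1 powr (p / 2) / Im \<zeta>2 powr (p / 2)) *
           cmod ((\<zeta>2 - of_real x) / (\<zeta>1 - of_real x)))"

definition delta_p_norm :: "real \<Rightarrow> complex \<Rightarrow> complex \<Rightarrow> real" where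
  "delta_p_norm p \<zeta> v = (cmod v + (1 - p) * Im v) / (2 * Im \<zeta>)"

end

theory Submission
  imports Defs
begin

text \<open>
  Write \<open>L z w\<close> for the hyperbolic distance of curvature \<open>-1\<close>. For every real \<open>x\<close> the function
  \<open>\<zeta> \<mapsto> ln \<bar>\<zeta> - x\<bar> - p/2 ln (Im \<zeta>)\<close> has a derivative dominated by the weak norm of \<open>\<delta>\<^sub>p\<close>, so its
  increments bound the length of every path from below; the supremum over \<open>x\<close> of these increments
  is \<open>\<delta>\<^sub>p\<close>. A quadratic discriminant shows that this supremum is at least
  \<open>K = L/2 + (1-p)/2 ln (Im w / Im z)\<close>, and the hyperbolic segment has length exactly \<open>K\<close>. Hence
  \<open>\<delta>\<^sub>p = K\<close> is the infimum of lengths. Since \<open>\<delta>\<^sub>p\<close> differs from \<open>L/2\<close> by a coboundary, its geodesics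
  are those of \<open>L\<close>, which are unique because the midpoint of two distinct points at equal distances
  from \<open>z\<close> and from \<open>w\<close> would be strictly closer to both.
\<close>

subsection \<open>Lengths and potentials\<close>

text \<open>On a closed piece the one-sided derivative \<open>D\<close> is known to agree with
  \<open>vector_derivative g (at t)\<close> only in the interior. The two endpoints do not affect
  the integral, so the length integrand can be exchanged for the continuous function
  \<open>N (g t) (D t)\<close>.\<close>

lemma finsler_integrand_has_integral_piece:
  fixes g :: "real \<Rightarrow> 'a::real_normed_vector" and N :: "'a \<Rightarrow> 'a \<Rightarrow> real"
  assumes ab: "a \<le> b"
    and N: "continuous_on (M \<times> UNIV) (\<lambda>(x, v). N x v)"
    and D: "continuous_on {a..b} D"
    and gD: "\<And>t. t \<in> {a..b} \<Longrightarrow> (g has_vector_derivative D t) (at t within {a..b})"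
    and gM: "\<And>t. t \<in> {a..b} \<Longrightarrow> g t \<in> M"
  shows "((\<lambda>t. N (g t) (vector_derivative g (at t))) has_integral
           integral {a..b} (\<lambda>t. N (g t) (D t))) {a..b}"
    and "(\<lambda>t. N (g t) (D t)) integrable_on {a..b}"
proof -
  have g: "continuous_on {a..b} g"
    unfolding continuous_on_eq_continuous_within
    using gD has_vector_derivative_continuous by blast
  have "continuous_on {a..b} ((\<lambda>(x, v). N x v) \<circ> (\<lambda>t. (g t, D t)))"
    by (rule continuous_on_compose) (use g D gM in \<open>auto intro!: continuous_intros continuous_on_subset[OF N]\<close>)
  then show int: "(\<lambda>t. N (g t) (D t)) integrable_on {a..b}"
    by (simp add: o_def integrable_continuous_interval)
  have eq: "N (g t) (vector_derivative g (at t)) = N (g t) (D t)" if "t \<in> {a..b} - {a, b}" for t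
  proof -
    have "(g has_vector_derivative D t) (at t)"
      using gD[of t] that at_within_Icc_at[of a t b] by auto
    then show ?thesis by (simp add: vector_derivative_at)
  qed
  show "((\<lambda>t. N (g t) (vector_derivative g (at t))) has_integral
           integral {a..b} (\<lambda>t. N (g t) (D t))) {a..b}"
    by (rule has_integral_spike_finite[where S="{a, b}", OF _ eq integrable_integral[OF int]]) auto
qed

lemma has_integral_derivative_along_path:
  fixes g :: "real \<Rightarrow> 'a::real_normed_vector" and \<Phi> :: "'a \<Rightarrow> real"
  assumes "a \<le> b"
    and gD: "\<And>t. t \<in> {a..b} \<Longrightarrow> (g has_vector_derivative D t) (at t within {a..b})"
    and d\<Phi>: "\<And>t. t \<in> {a..b} \<Longrightarrow> (\<Phi> has_derivative \<Phi>' (g t)) (at (g t))"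
  shows "((\<lambda>t. \<Phi>' (g t) (D t)) has_integral (\<Phi> (g b) - \<Phi> (g a))) {a..b}"
proof -
  have "((\<Phi> \<circ> g) has_vector_derivative \<Phi>' (g t) (D t)) (at t within {a..b})" if "t \<in> {a..b}" for t
    by (rule vector_derivative_diff_chain_within[OF gD[OF that] has_derivative_at_withinI[OF d\<Phi>[OF that]]])
  from fundamental_theorem_of_calculus[OF \<open>a \<le> b\<close> this] show ?thesis by simp
qed

text \<open>A calibration argument: on each piece the increment of \<Phi> is the integral of
  \<open>\<Phi>' (g t) (D t)\<close>, which the weak norm dominates pointwise. Summing over the
  pieces gives the bound.\<close>

lemma finsler_length_ge_potential_difference:
  fixes \<Phi> :: "'a::real_normed_vector \<Rightarrow> real"
  assumes g: "g \<in> piecewise_C1_paths M x y"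
    and N: "continuous_on (M \<times> UNIV) (\<lambda>(x, v). N x v)"
    and d\<Phi>: "\<And>z. z \<in> M \<Longrightarrow> (\<Phi> has_derivative \<Phi>' z) (at z)"
    and le: "\<And>z v. z \<in> M \<Longrightarrow> \<Phi>' z v \<le> N z v"
  shows "\<Phi> y - \<Phi> x \<le> finsler_length N g"
proof -
  from g obtain n :: nat and a :: "nat \<Rightarrow> real" where a0: "a 0 = 0" and an: "a n = 1"
    and mono: "\<And>i. i < n \<Longrightarrow> a i < a (Suc i)"
    and piece: "\<And>i. i < n \<Longrightarrow> \<exists>D. continuous_on {a i..a (Suc i)} D \<and>
           (\<forall>t\<in>{a i..a (Suc i)}. (g has_vector_derivative D t) (at t within {a i..a (Suc i)}))"
    unfolding piecewise_C1_paths_def piecewise_C1_path_def by blast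
  from g have gM: "g t \<in> M" if "t \<in> {0..1}" for t
    using that by (auto simp: piecewise_C1_paths_def path_image_def)
  from g have ends: "g 0 = x" "g 1 = y"
    by (auto simp: piecewise_C1_paths_def pathstart_def pathfinish_def)
  let ?f = "\<lambda>t. N (g t) (vector_derivative g (at t))"
  have le_a: "a i \<le> a j" if "i \<le> j" "j \<le> n" for i j
    using that
  proof (induction j rule: dec_induct)
    case (step k)
    with mono[of k] show ?case by simp
  qed simp
  \<comment> \<open>Integrability is carried through the induction together with the bound: for a
    non-integrable integrand \<open>integral\<close> would be the default value 0 and say nothing
    about the path.\<close>
  have "\<exists>I. (?f has_integral I) {0..a k} \<and> \<Phi> (g (a k)) - \<Phi> (g 0) \<le> I" if "k \<le> n" for k
    using that
  proof (induction k)
    case 0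
    have "(?f has_integral 0) {0..0}" by (metis box_real(2) has_integral_refl(1))
    then show ?case by (intro exI[of _ 0]) (simp add: a0)
  next
    case (Suc k)
    then obtain I where I: "(?f has_integral I) {0..a k}" "\<Phi> (g (a k)) - \<Phi> (g 0) \<le> I" by auto
    from Suc.prems obtain D where D: "continuous_on {a k..a (Suc k)} D"
      "\<And>t. t \<in> {a k..a (Suc k)} \<Longrightarrow> (g has_vector_derivative D t) (at t within {a k..a (Suc k)})"
      using piece[of k] by auto
    have ak: "a k \<le> a (Suc k)" "0 \<le> a k" "a (Suc k) \<le> 1"
      using Suc.prems le_a[of 0 k] le_a[of k "Suc k"] le_a[of "Suc k" n] a0 an by auto
    then have M: "g t \<in> M" if "t \<in> {a k..a (Suc k)}" for t
      using gM[of t] that by auto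
    note J = finsler_integrand_has_integral_piece[OF ak(1) N D M]
    have "\<Phi> (g (a (Suc k))) - \<Phi> (g (a k)) \<le> integral {a k..a (Suc k)} (\<lambda>t. N (g t) (D t))"
      by (rule has_integral_le[OF has_integral_derivative_along_path[OF ak(1) D(2) d\<Phi>] integrable_integral[OF J(2)]])
        (use M le in auto)
    with I(2) has_integral_combine[OF ak(2) ak(1) I(1) J(1)] show ?case
      by (intro exI[of _ "I + integral {a k..a (Suc k)} (\<lambda>t. N (g t) (D t))"]) auto
  qed
  from this[of n] show ?thesis
    using integral_unique by (force simp: an ends finsler_length_def)
qed

section \<open>Logarithmic potentials on the half-plane\<close>

text \<open>With \<open>u = Re \<zeta> - x\<close> and \<open>y = Im \<zeta>\<close>, the vector
  \<open>2y (u, y) / (u^2 + y^2) - (0, 1)\<close> equals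
  \<open>(2uy, y^2 - u^2) / (u^2 + y^2)\<close>, which has norm 1. Its inner product with
  \<open>v\<close> is therefore at most \<open>cmod v\<close>; this is the case
  \<open>p = 0\<close>, and the term in \<open>p\<close> is the same on both sides.\<close>

lemma delta_p_potential_derivative_le:
  assumes "Im \<zeta> > 0"
  shows "((Re \<zeta> - x) * Re v + Im \<zeta> * Im v) / ((Re \<zeta> - x)\<^sup>2 + (Im \<zeta>)\<^sup>2) - p * Im v / (2 * Im \<zeta>)
           \<le> delta_p_norm p \<zeta> v"
proof -
  define u y where "u = Re \<zeta> - x" and "y = Im \<zeta>"
  have y: "y > 0" using assms by (simp add: y_def)
  have pos: "u\<^sup>2 + y\<^sup>2 > 0" using y by (simp add: add_nonneg_pos)
  have "cmod (Complex (2*u*y) (u\<^sup>2 - y\<^sup>2)) = u\<^sup>2 + y\<^sup>2"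
  proof -
    have "(2*u*y)\<^sup>2 + (u\<^sup>2 - y\<^sup>2)\<^sup>2 = (u\<^sup>2 + y\<^sup>2)\<^sup>2"
      by (simp add: power2_eq_square algebra_simps)
    then show ?thesis using pos by (simp add: cmod_def)
  qed
  then have "Re (v * Complex (2*u*y) (u\<^sup>2 - y\<^sup>2)) \<le> cmod v * (u\<^sup>2 + y\<^sup>2)"
    using complex_Re_le_cmod[of "v * Complex (2*u*y) (u\<^sup>2 - y\<^sup>2)"] by (simp add: norm_mult)
  then have *: "2*y*(u * Re v + y * Im v) \<le> (cmod v + Im v) * (u\<^sup>2 + y\<^sup>2)"
    by (simp add: power2_eq_square algebra_simps)
  have "(u * Re v + y * Im v) / (u\<^sup>2 + y\<^sup>2) \<le> (cmod v + Im v) / (2*y)"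
    using * pos y by (simp add: field_simps)
  moreover have "delta_p_norm p \<zeta> v = (cmod v + Im v) / (2*y) - p * Im v / (2*y)"
    by (simp add: delta_p_norm_def y_def diff_divide_distrib[symmetric] algebra_simps)
  ultimately show ?thesis by (simp add: u_def y_def)
qed

text \<open>The logarithm of the modulus is written as half the logarithm of a sum of squares, which
  is easy to differentiate. For \<open>p = 1\<close> this is a Busemann function of the boundary
  point \<open>x\<close> for the metric of curvature -4.\<close>

definition potential :: "real \<Rightarrow> real \<Rightarrow> complex \<Rightarrow> real" where
  "potential p x \<zeta> = ln ((Re \<zeta> - x)\<^sup>2 + (Im \<zeta>)\<^sup>2) / 2 - p / 2 * ln (Im \<zeta>)"

lemma potential_has_derivative:
  assumes "Im \<zeta> > 0"
  shows "(potential p x has_derivative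
    (\<lambda>v. ((Re \<zeta> - x) * Re v + Im \<zeta> * Im v) / ((Re \<zeta> - x)\<^sup>2 + (Im \<zeta>)\<^sup>2) - p * Im v / (2 * Im \<zeta>))) (at \<zeta>)"
proof -
  define S where "S \<equiv> \<lambda>\<zeta>. (Re \<zeta> - x)\<^sup>2 + (Im \<zeta>)\<^sup>2"
  have pos: "S \<zeta> > 0" using assms by (simp add: S_def add_nonneg_pos)
  have dS: "(S has_derivative (\<lambda>v. 2 * ((Re \<zeta> - x) * Re v + Im \<zeta> * Im v))) (at \<zeta>)"
    unfolding S_def by (auto intro!: derivative_eq_intros simp: algebra_simps)
  have "((\<lambda>\<zeta>. ln (S \<zeta>) / 2 - p / 2 * ln (Im \<zeta>)) has_derivative
      (\<lambda>v. ((Re \<zeta> - x) * Re v + Im \<zeta> * Im v) / S \<zeta> - p * Im v / (2 * Im \<zeta>))) (at \<zeta>)"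
    using assms pos by (auto intro!: derivative_eq_intros dS simp: field_simps)
  then show ?thesis by (simp add: potential_def [abs_def] S_def)
qed

lemma continuous_on_delta_p_norm:
  "continuous_on (upper_half_plane \<times> UNIV) (\<lambda>(\<zeta>, v). delta_p_norm p \<zeta> v)"
  unfolding delta_p_norm_def case_prod_unfold
  by (intro continuous_intros) (auto simp: upper_half_plane_def)

lemma finsler_length_delta_p_ge:
  assumes "g \<in> piecewise_C1_paths upper_half_plane z w"
  shows "potential p x w - potential p x z \<le> finsler_length (delta_p_norm p) g"
  by (rule finsler_length_ge_potential_difference[OF assms continuous_on_delta_p_norm potential_has_derivative])
    (auto simp: upper_half_plane_def delta_p_potential_derivative_le)

text \<open>Identifies the increments of the potentials with the logarithms of the terms whose
  supremum defines \<open>delta_p\<close>.\<close>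

lemma exp_potential_difference:
  assumes "Im z > 0" "Im w > 0"
  shows "exp (potential p x w - potential p x z) =
     Im z powr (p / 2) / Im w powr (p / 2) * cmod ((w - of_real x) / (z - of_real x))"
proof -
  have e: "exp (ln ((Re \<zeta> - x)\<^sup>2 + (Im \<zeta>)\<^sup>2) / 2) = cmod (\<zeta> - of_real x)" if "Im \<zeta> > 0" for \<zeta>
  proof -
    have "(Re \<zeta> - x)\<^sup>2 + (Im \<zeta>)\<^sup>2 > 0" using that by (simp add: add_nonneg_pos)
    then show ?thesis by (simp add: cmod_def ln_sqrt[symmetric])
  qed
  show ?thesis
    using assms by (simp add: potential_def exp_diff e powr_def norm_divide)
qed

subsection \<open>Hyperbolic segments\<close>

text \<open>The classical formula for the cosh of the distance of curvature -1. That
  \<open>hyp_len\<close> really is twice the infimum \<open>hyp_dist\<close> is established in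
  \<open>hyp_dist_eq\<close>.\<close>

definition hyp_cosh :: "complex \<Rightarrow> complex \<Rightarrow> real" where
  "hyp_cosh z w = 1 + (cmod (z - w))\<^sup>2 / (2 * Im z * Im w)"

definition hyp_len :: "complex \<Rightarrow> complex \<Rightarrow> real" where
  "hyp_len z w = arcosh (hyp_cosh z w)"

lemma hyp_cosh_commute: "hyp_cosh z w = hyp_cosh w z"
  by (simp add: hyp_cosh_def norm_minus_commute mult.commute mult.left_commute)

lemma hyp_len_commute: "hyp_len z w = hyp_len w z"
  by (simp add: hyp_len_def hyp_cosh_commute)

lemma hyp_cosh_eq:
  assumes "Im z > 0" "Im w > 0"
  shows "hyp_cosh z w = ((Re z - Re w)\<^sup>2 + (Im z)\<^sup>2 + (Im w)\<^sup>2) / (2 * Im z * Im w)"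
  using assms by (simp add: hyp_cosh_def cmod_power2) (simp add: field_simps power2_eq_square)

lemma hyp_cosh_ge_1: "Im z > 0 \<Longrightarrow> Im w > 0 \<Longrightarrow> hyp_cosh z w \<ge> 1"
  by (simp add: hyp_cosh_def)

lemma cosh_hyp_len: "Im z > 0 \<Longrightarrow> Im w > 0 \<Longrightarrow> cosh (hyp_len z w) = hyp_cosh z w"
  by (simp add: hyp_len_def hyp_cosh_ge_1)

lemma hyp_len_nonneg: "Im z > 0 \<Longrightarrow> Im w > 0 \<Longrightarrow> hyp_len z w \<ge> 0"
  by (simp add: hyp_len_def hyp_cosh_ge_1)

lemma hyp_len_eq_0_iff: "Im z > 0 \<Longrightarrow> Im w > 0 \<Longrightarrow> hyp_len z w = 0 \<longleftrightarrow> z = w"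
  using hyp_cosh_ge_1[of z w] by (simp add: hyp_len_def) (simp add: hyp_cosh_def)

text \<open>Dropping the horizontal term \<open>(Re z - Re w)^2\<close> from \<open>hyp_cosh\<close>
  leaves the cosh of the logarithm of the ratio of heights. This estimate gives the nonnegativity of
  \<open>delta_p\<close>.\<close>

lemma hyp_len_ge_abs_ln:
  assumes "Im z > 0" "Im w > 0"
  shows "\<bar>ln (Im w / Im z)\<bar> \<le> hyp_len z w"
proof -
  have "cosh (ln (Im w / Im z)) = ((Im z)\<^sup>2 + (Im w)\<^sup>2) / (2 * Im z * Im w)"
    using assms by (simp add: cosh_ln_real field_simps power2_eq_square)
  also have "\<dots> \<le> hyp_cosh z w"
    using assms by (simp add: hyp_cosh_eq divide_right_mono)
  finally have "cosh \<bar>ln (Im w / Im z)\<bar> \<le> cosh (hyp_len z w)"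
    using assms by (simp add: cosh_hyp_len)
  then show ?thesis
    using assms by (subst (asm) cosh_real_nonneg_le_iff) (auto simp: hyp_len_nonneg)
qed

section \<open>Combinations of points in the hyperboloid model\<close>

text \<open>
  In the hyperboloid model a point \<open>z\<close> is the vector \<open>(1, Re z, \<bar>z\<bar>\<^sup>2) / Im z\<close>
  and \<^term>\<open>hyp_cosh\<close> is the restriction of the Minkowski bilinear form. The following is the
  point corresponding to a linear combination of two such vectors.
\<close>

definition hyperboloid_comb :: "real \<Rightarrow> real \<Rightarrow> complex \<Rightarrow> complex \<Rightarrow> complex" where
  "hyperboloid_comb a b z w =
     (of_real (a * (Re z / Im z) + b * (Re w / Im w)) + \<i>) / of_real (a * (1 / Im z) + b * (1 / Im w))"

text \<open>The assumption \<open>unit\<close> says that the Minkowski form takes the value 1 on the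
  combined vector, so that this vector lies on the hyperboloid again. Then \<open>hyp_cosh\<close>
  is linear in it because the form is bilinear.\<close>

lemma
  assumes z: "Im z > 0" and w: "Im w > 0" and "a \<ge> 0" "b \<ge> 0"
    and unit: "a\<^sup>2 + b\<^sup>2 + 2 * a * b * hyp_cosh z w = 1"
  shows hyperboloid_comb_denom_pos: "a * (1 / Im z) + b * (1 / Im w) > 0"
    and Im_hyperboloid_comb_pos: "Im (hyperboloid_comb a b z w) > 0"
    and hyp_cosh_hyperboloid_comb:
      "Im u > 0 \<Longrightarrow> hyp_cosh (hyperboloid_comb a b z w) u = a * hyp_cosh z u + b * hyp_cosh w u"
proof -
  define X Y X' Y' where "X = Re z" and "Y = Im z" and "X' = Re w" and "Y' = Im w"
  define \<alpha> \<beta> where "\<alpha> = a / Y" and "\<beta> = b / Y'"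
  have Y: "Y > 0" "Y' > 0" using z w by (auto simp: Y_def Y'_def)
  have ab: "a = \<alpha> * Y" "b = \<beta> * Y'" using Y by (auto simp: \<alpha>_def \<beta>_def)
  have "\<alpha> \<ge> 0" "\<beta> \<ge> 0" using assms Y by (auto simp: \<alpha>_def \<beta>_def)
  define r s where "r = \<alpha> * X + \<beta> * X'" and "s = \<alpha> + \<beta>"
  have "a \<noteq> 0 \<or> b \<noteq> 0" using unit by auto
  then have "\<alpha> \<noteq> 0 \<or> \<beta> \<noteq> 0" using Y by (auto simp: ab)
  then have s: "s > 0" using \<open>\<alpha> \<ge> 0\<close> \<open>\<beta> \<ge> 0\<close> by (auto simp: s_def)
  have s_eq: "a * (1 / Im z) + b * (1 / Im w) = s"
    by (simp add: s_def \<alpha>_def \<beta>_def Y_def Y'_def)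
  then show "a * (1 / Im z) + b * (1 / Im w) > 0" using s by simp
  have r_eq: "a * (Re z / Im z) + b * (Re w / Im w) = r"
    by (simp add: r_def \<alpha>_def \<beta>_def Y_def Y'_def X_def X'_def)
  have comb: "Re (hyperboloid_comb a b z w) = r / s" "Im (hyperboloid_comb a b z w) = 1 / s"
    unfolding hyperboloid_comb_def s_eq r_eq by simp_all
  show pos: "Im (hyperboloid_comb a b z w) > 0" using s by (simp add: comb)
  have "2 * a * b * hyp_cosh z w = \<alpha> * \<beta> * ((X - X')\<^sup>2 + Y\<^sup>2 + Y'\<^sup>2)"
    using Y by (simp add: hyp_cosh_eq[OF z w] ab flip: X_def X'_def Y_def Y'_def)
  with unit have "1 = a\<^sup>2 + b\<^sup>2 + \<alpha> * \<beta> * ((X - X')\<^sup>2 + Y\<^sup>2 + Y'\<^sup>2)"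
    by linarith
  then have "1 = (\<alpha> * Y)\<^sup>2 + (\<beta> * Y')\<^sup>2 + \<alpha> * \<beta> * ((X - X')\<^sup>2 + Y\<^sup>2 + Y'\<^sup>2)"
    unfolding ab .
  \<comment> \<open>The combined point is \<open>(r + \<i>) / s\<close>, so its third hyperboloid
    coordinate is \<open>(r^2 + 1) / s\<close>. The equation says that this is the same linear
    combination of the third coordinates of \<open>z\<close> and \<open>w\<close>.\<close>
  then have key: "r\<^sup>2 + 1 = s * (\<alpha> * (X\<^sup>2 + Y\<^sup>2) + \<beta> * (X'\<^sup>2 + Y'\<^sup>2))"
    by (simp add: r_def s_def power2_eq_square algebra_simps)
  assume u: "Im u > 0"
  define U V where "U = Re u" and "V = Im u"
  have V: "V > 0" using u by (simp add: V_def)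
  have "hyp_cosh (hyperboloid_comb a b z w) u = ((r / s - U)\<^sup>2 + (1 / s)\<^sup>2 + V\<^sup>2) / (2 * (1 / s) * V)"
    using pos u by (simp add: hyp_cosh_eq comb U_def V_def)
  also have "\<dots> = ((r\<^sup>2 + 1) / s - 2 * r * U + s * (U\<^sup>2 + V\<^sup>2)) / (2 * V)"
    using s V by (simp add: field_simps power2_eq_square)
  also have "\<dots> = (\<alpha> * (X\<^sup>2 + Y\<^sup>2) + \<beta> * (X'\<^sup>2 + Y'\<^sup>2) - 2 * r * U + s * (U\<^sup>2 + V\<^sup>2)) / (2 * V)"
    using s by (simp add: key)
  also have "\<dots> = (\<alpha> * ((X - U)\<^sup>2 + Y\<^sup>2 + V\<^sup>2) + \<beta> * ((X' - U)\<^sup>2 + Y'\<^sup>2 + V\<^sup>2)) / (2 * V)"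
    by (simp add: r_def s_def power2_eq_square algebra_simps)
  also have "\<dots> = a * hyp_cosh z u + b * hyp_cosh w u"
    using z w u V Y by (simp add: hyp_cosh_eq ab add_divide_distrib distrib_left flip: X_def X'_def Y_def Y'_def U_def V_def)
  finally show "hyp_cosh (hyperboloid_comb a b z w) u = a * hyp_cosh z u + b * hyp_cosh w u" .
qed

text \<open>The condition \<open>unit\<close> for the coefficients
  \<open>sinh A / sinh (A + B)\<close> and \<open>sinh B / sinh (A + B)\<close> of two points at
  distance \<open>A + B\<close>, cleared of denominators.\<close>

lemma sinh_add_square:
  fixes A B :: real
  shows "(sinh A)\<^sup>2 + (sinh B)\<^sup>2 + 2 * sinh A * sinh B * cosh (A + B) = (sinh (A + B))\<^sup>2"
  using cosh_square_eq[of A] cosh_square_eq[of B] unfolding sinh_add cosh_add by algebra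

text \<open>As functions of \<open>s\<close>, both sides solve \<open>f'' = L^2 f\<close> and agree
  at \<open>s = 0\<close> and \<open>s = 1\<close>. The identity evaluates the Minkowski form along
  a segment.\<close>

lemma sinh_cosh_interpolate:
  fixes L s t :: real
  shows "sinh ((1 - s) * L) * cosh (t * L) + sinh (s * L) * cosh ((1 - t) * L) = sinh L * cosh ((s - t) * L)"
proof -
  have *: "sinh ((1 - r) * L) = sinh L * cosh (r * L) - cosh L * sinh (r * L)"
    "cosh ((1 - r) * L) = cosh L * cosh (r * L) - sinh L * sinh (r * L)" for r
    by (simp_all add: left_diff_distrib sinh_diff cosh_diff)
  show ?thesis unfolding * left_diff_distrib[of s t] cosh_diff by (simp add: algebra_simps)
qed

section \<open>Segments and the distances between their points\<close>

text \<open>The hyperbolic counterpart of spherical linear interpolation. For \<open>z = w\<close>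
  both coefficients are divisions by 0, and the value is the point 0 outside the half-plane; hence
  the assumption \<open>z \<noteq> w\<close> in the context below.\<close>

definition hyp_segment :: "complex \<Rightarrow> complex \<Rightarrow> real \<Rightarrow> complex" where
  "hyp_segment z w s =
     (let L = hyp_len z w
      in hyperboloid_comb (sinh ((1 - s) * L) / sinh L) (sinh (s * L) / sinh L) z w)"

context
  fixes z w :: complex and L :: real
  assumes z: "Im z > 0" and w: "Im w > 0" and zw: "z \<noteq> w"
  defines L_def: "L \<equiv> hyp_len z w"
begin

lemma hyp_len_pos: "L > 0"
  using hyp_len_nonneg[OF z w] hyp_len_eq_0_iff[OF z w] zw by (auto simp: L_def less_le)

lemma hyp_segment_coeffs:
  assumes "s \<in> {0..1}"
  shows "sinh ((1 - s) * L) / sinh L \<ge> 0" "sinh (s * L) / sinh L \<ge> 0"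
    "(sinh ((1 - s) * L) / sinh L)\<^sup>2 + (sinh (s * L) / sinh L)\<^sup>2
       + 2 * (sinh ((1 - s) * L) / sinh L) * (sinh (s * L) / sinh L) * hyp_cosh z w = 1"
proof -
  have S: "sinh L > 0" using hyp_len_pos by simp
  show "sinh ((1 - s) * L) / sinh L \<ge> 0" "sinh (s * L) / sinh L \<ge> 0"
    using S hyp_len_pos assms by auto
  have c: "hyp_cosh z w = cosh ((1 - s) * L + s * L)"
    by (simp add: algebra_simps L_def cosh_hyp_len[OF z w])
  have "(sinh ((1 - s) * L))\<^sup>2 + (sinh (s * L))\<^sup>2
       + 2 * (sinh ((1 - s) * L)) * (sinh (s * L)) * hyp_cosh z w = (sinh L)\<^sup>2"
    unfolding c sinh_add_square by (simp add: algebra_simps)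
  then show "(sinh ((1 - s) * L) / sinh L)\<^sup>2 + (sinh (s * L) / sinh L)\<^sup>2
       + 2 * (sinh ((1 - s) * L) / sinh L) * (sinh (s * L) / sinh L) * hyp_cosh z w = 1"
    using S by (simp add: field_simps power2_eq_square)
qed

lemma Im_hyp_segment_pos: "s \<in> {0..1} \<Longrightarrow> Im (hyp_segment z w s) > 0"
  unfolding hyp_segment_def Let_def L_def[symmetric]
  by (intro Im_hyperboloid_comb_pos z w hyp_segment_coeffs)

lemma hyp_cosh_hyp_segment:
  assumes "s \<in> {0..1}" "Im u > 0"
  shows "hyp_cosh (hyp_segment z w s) u =
     (sinh ((1 - s) * L) * hyp_cosh z u + sinh (s * L) * hyp_cosh w u) / sinh L"
  unfolding hyp_segment_def Let_def L_def[symmetric]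
  by (subst hyp_cosh_hyperboloid_comb[OF z w hyp_segment_coeffs[OF assms(1)] assms(2)])
    (simp add: add_divide_distrib)

lemma hyp_segment_0: "hyp_segment z w 0 = z"
  using hyp_len_pos z by (simp add: hyp_segment_def hyperboloid_comb_def L_def[symmetric] complex_eq_iff)

lemma hyp_segment_1: "hyp_segment z w 1 = w"
  using hyp_len_pos w by (simp add: hyp_segment_def hyperboloid_comb_def L_def[symmetric] complex_eq_iff)

text \<open>Linearity is used twice: first against the endpoints \<open>z\<close> and
  \<open>w\<close>, where it gives \<open>cosh (t * L)\<close> and
  \<open>cosh ((1 - t) * L)\<close>, and then against the point with parameter \<open>t\<close>,
  where these two values are interpolated.\<close>

lemma hyp_cosh_hyp_segment_segment:
  assumes s: "s \<in> {0..1}" and t: "t \<in> {0..1}"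
  shows "hyp_cosh (hyp_segment z w s) (hyp_segment z w t) = cosh ((s - t) * L)"
proof -
  have S: "sinh L > 0" using hyp_len_pos by simp
  have c: "hyp_cosh z w = cosh L" "hyp_cosh w z = cosh L" "hyp_cosh z z = 1" "hyp_cosh w w = 1"
    using cosh_hyp_len[OF z w] by (simp_all add: L_def hyp_cosh_commute) (simp_all add: hyp_cosh_def)
  have "hyp_cosh z (hyp_segment z w t) = (sinh ((1 - t) * L) * 1 + sinh (t * L) * cosh L) / sinh L"
    using hyp_cosh_hyp_segment[OF t z] by (simp only: c hyp_cosh_commute[of "hyp_segment z w t"])
  also have "sinh ((1 - t) * L) * 1 + sinh (t * L) * cosh L = sinh L * cosh (t * L)"
    using sinh_cosh_interpolate[of t L 0] by simp
  finally have tz: "hyp_cosh z (hyp_segment z w t) = cosh (t * L)" using S by simp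
  have "hyp_cosh w (hyp_segment z w t) = (sinh ((1 - t) * L) * cosh L + sinh (t * L) * 1) / sinh L"
    using hyp_cosh_hyp_segment[OF t w] by (simp only: c hyp_cosh_commute[of "hyp_segment z w t"])
  also have "sinh ((1 - t) * L) * cosh L + sinh (t * L) * 1 = sinh L * cosh (- ((t - 1) * L))"
    using sinh_cosh_interpolate[of t L 1] by (simp only: cosh_minus) simp
  finally have tw: "hyp_cosh w (hyp_segment z w t) = cosh ((1 - t) * L)"
    using S by (simp add: algebra_simps)
  show ?thesis
    using hyp_cosh_hyp_segment[OF s Im_hyp_segment_pos[OF t]] S
    by (simp add: tz tw sinh_cosh_interpolate)
qed

lemma hyp_len_hyp_segment:
  assumes s: "s \<in> {0..1}" and t: "t \<in> {0..1}"
  shows "hyp_len (hyp_segment z w s) (hyp_segment z w t) = \<bar>s - t\<bar> * L"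
proof -
  have "cosh ((s - t) * L) = cosh (\<bar>s - t\<bar> * L)"
    using cosh_real_abs[of "(s - t) * L"] hyp_len_pos by (simp add: abs_mult)
  then show ?thesis
    using hyp_len_pos by (simp only: hyp_len_def hyp_cosh_hyp_segment_segment[OF s t]) (simp add: arcosh_cosh_real)
qed

text \<open>At the midpoint both coefficients equal \<open>1 / (2 * cosh (L / 2))\<close>. As
  \<open>cosh (L / 2) > 1\<close>, this yields the strict convexity behind the uniqueness of
  geodesics.\<close>

lemma hyp_cosh_hyp_segment_midpoint:
  assumes "Im u > 0"
  shows "hyp_cosh (hyp_segment z w (1/2)) u = (hyp_cosh z u + hyp_cosh w u) / (2 * cosh (L / 2))"
proof -
  have "sinh (L / 2) / sinh L = 1 / (2 * cosh (L / 2))"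
    using sinh_double[of "L / 2"] hyp_len_pos by simp
  then show ?thesis
    using hyp_cosh_hyp_segment[of "1/2" u] assms
    by (simp add: add_divide_distrib) (metis mult.commute times_divide_eq_right mult_1_right)
qed

section \<open>Smoothness and speed of segments\<close>

lemma hyp_segment_C1:
  obtains D where "continuous_on {0..1} D"
    "\<And>t. t \<in> {0..1} \<Longrightarrow> (hyp_segment z w has_vector_derivative D t) (at t within {0..1})"
proof -
  define a b where "a s = sinh ((1 - s) * L) / sinh L" and "b s = sinh (s * L) / sinh L" for s :: real
  define a' b' where "a' s = - L * cosh ((1 - s) * L) / sinh L" and "b' s = L * cosh (s * L) / sinh L" for s :: real
  define N where "N s = complex_of_real (a s * (Re z / Im z) + b s * (Re w / Im w)) + \<i>" for s
  define E where "E s = complex_of_real (a s * (1 / Im z) + b s * (1 / Im w))" for s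
  define N' where "N' s = complex_of_real (a' s * (Re z / Im z) + b' s * (Re w / Im w))" for s
  define E' where "E' s = complex_of_real (a' s * (1 / Im z) + b' s * (1 / Im w))" for s
  have g: "hyp_segment z w = (\<lambda>s. N s / E s)"
    by (simp add: fun_eq_iff hyp_segment_def hyperboloid_comb_def Let_def N_def E_def a_def b_def L_def)
  have E0: "E s \<noteq> 0" if "s \<in> {0..1}" for s
    using hyperboloid_comb_denom_pos[OF z w hyp_segment_coeffs[OF that]]
    unfolding E_def a_def b_def of_real_eq_0_iff by linarith
  have da: "(a has_real_derivative a' s) (at s within A)" "(b has_real_derivative b' s) (at s within A)" for s A
    unfolding a_def b_def a'_def b'_def using hyp_len_pos by (auto intro!: derivative_eq_intros)
  note da' = da[unfolded has_real_derivative_iff_has_vector_derivative]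
  have dN: "(N has_vector_derivative N' s) (at s within A)" for s A
    unfolding N_def N'_def
    by (auto intro!: derivative_eq_intros da da' simp: has_real_derivative_iff_has_vector_derivative[symmetric])
  have dE: "(E has_vector_derivative E' s) (at s within A)" for s A
    unfolding E_def E'_def
    by (auto intro!: derivative_eq_intros da da' simp: has_real_derivative_iff_has_vector_derivative[symmetric])
  define D where "D s = (N' s * E s - N s * E' s) / (E s * E s)" for s
  have cont: "continuous_on {0..1} N" "continuous_on {0..1} E"
    by (auto simp: continuous_on_eq_continuous_within
        intro: has_vector_derivative_continuous[OF dN] has_vector_derivative_continuous[OF dE])
  have "continuous_on {0..1} N'" "continuous_on {0..1} E'"
    unfolding N'_def E'_def a'_def b'_def using hyp_len_pos z w by (auto intro!: continuous_intros)
  then have "continuous_on {0..1} D"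
    unfolding D_def using cont E0 by (auto intro!: continuous_intros)
  moreover have "(hyp_segment z w has_vector_derivative D t) (at t within {0..1})" if "t \<in> {0..1}" for t
  proof -
    have "((\<lambda>s. N s / E s) has_derivative (\<lambda>h. - N t * (inverse (E t) * (h *\<^sub>R E' t) * inverse (E t)) + (h *\<^sub>R N' t) / E t)) (at t within {0..1})"
      using dN[of t] dE[of t] E0[OF that] unfolding has_vector_derivative_def
      by (intro has_derivative_divide) auto
    then show ?thesis
      unfolding g has_vector_derivative_def
      by (rule has_derivative_eq_rhs) (use E0[OF that] in \<open>auto simp: D_def field_simps scaleR_conv_of_real\<close>)
  qed
  ultimately show ?thesis using that by blast
qed

text \<open>The speed is read off from the distances instead of a formula for the derivative:
  \<open>hyp_cosh - 1\<close> is both a multiple of the squared chord and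
  \<open>2 (sinh ((s - t) * L / 2))^2\<close>, so the norm of the difference quotient has a
  computable limit.\<close>

lemma norm_derivative_hyp_segment:
  assumes t: "t \<in> {0..1}" and D: "(hyp_segment z w has_vector_derivative D) (at t within {0..1})"
  shows "norm D = L * Im (hyp_segment z w t)"
proof -
  let ?g = "hyp_segment z w" and ?F = "at t within {0..1::real}"
  have nb: "?F \<noteq> bot"
    using t by (simp add: trivial_limit_within)
  have lim: "((\<lambda>s. norm ((?g s - ?g t) /\<^sub>R (s - t))) \<longlongrightarrow> norm D) ?F"
  proof (rule tendsto_norm)
    have "((\<lambda>s. norm (?g s - ?g t - (s - t) *\<^sub>R D) / norm (s - t)) \<longlongrightarrow> 0) ?F"
      using D by (simp add: has_vector_derivative_def has_derivative_iff_norm)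
    moreover have "eventually (\<lambda>s. norm (?g s - ?g t - (s - t) *\<^sub>R D) / norm (s - t)
        = norm ((?g s - ?g t) /\<^sub>R (s - t) - D)) ?F"
    proof (unfold eventually_at_filter, intro always_eventually allI impI)
      fix s :: real assume "s \<noteq> t"
      then have "(?g s - ?g t) /\<^sub>R (s - t) - D = (?g s - ?g t - (s - t) *\<^sub>R D) /\<^sub>R (s - t)"
        by (simp add: scaleR_diff_right)
      then show "norm (?g s - ?g t - (s - t) *\<^sub>R D) / norm (s - t) = norm ((?g s - ?g t) /\<^sub>R (s - t) - D)"
        by (simp add: divide_inverse_commute)
    qed
    ultimately have "((\<lambda>s. norm ((?g s - ?g t) /\<^sub>R (s - t) - D)) \<longlongrightarrow> 0) ?F"
      by (rule Lim_transform_eventually)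
    then show "((\<lambda>s. (?g s - ?g t) /\<^sub>R (s - t)) \<longlongrightarrow> D) ?F"
      by (rule LIM_zero_cancel[OF tendsto_norm_zero_cancel])
  qed
  \<comment> \<open>Since this function vanishes at \<open>s = t\<close>, its derivative there is
    the limit of its quotient by \<open>s - t\<close>.\<close>
  have "((\<lambda>s. sinh ((s - t) * L / 2)) has_real_derivative (L / 2)) ?F"
    by (auto intro!: derivative_eq_intros)
  then have "((\<lambda>s. sinh ((s - t) * L / 2) / (s - t)) \<longlongrightarrow> L / 2) ?F"
    by (simp add: has_field_derivative_iff)
  moreover have "(?g \<longlongrightarrow> ?g t) ?F"
    using has_vector_derivative_continuous[OF D] by (simp add: continuous_within)
  ultimately have "((\<lambda>s. 4 * Im (?g s) * Im (?g t) * (sinh ((s - t) * L / 2) / (s - t))\<^sup>2) \<longlongrightarrow>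
      4 * Im (?g t) * Im (?g t) * (L / 2)\<^sup>2) ?F"
    by (intro tendsto_mult tendsto_power tendsto_const tendsto_Im)
  moreover have "eventually (\<lambda>s. 4 * Im (?g s) * Im (?g t) * (sinh ((s - t) * L / 2) / (s - t))\<^sup>2
      = (norm ((?g s - ?g t) /\<^sub>R (s - t)))\<^sup>2) ?F"
  proof (unfold eventually_at_filter, intro always_eventually allI impI)
    fix s assume "s \<noteq> t" and s: "s \<in> {0..1}"
    have pos: "Im (?g s) > 0" "Im (?g t) > 0" using Im_hyp_segment_pos s t by auto
    have "(norm (?g s - ?g t))\<^sup>2 = 2 * Im (?g s) * Im (?g t) * (hyp_cosh (?g s) (?g t) - 1)"
      using pos by (simp add: hyp_cosh_def)
    also have "hyp_cosh (?g s) (?g t) - 1 = 2 * (sinh ((s - t) * L / 2))\<^sup>2"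
      using cosh_double[of "(s - t) * L / 2"]
      by (simp add: hyp_cosh_hyp_segment_segment[OF s t] cosh_square_eq)
    finally have "4 * Im (?g s) * Im (?g t) * (sinh ((s - t) * L / 2))\<^sup>2 = (norm (?g s - ?g t))\<^sup>2"
      by simp
    moreover have "norm ((?g s - ?g t) /\<^sub>R (s - t)) = norm (?g s - ?g t) / \<bar>s - t\<bar>"
      by (simp add: divide_inverse_commute)
    ultimately show "4 * Im (?g s) * Im (?g t) * (sinh ((s - t) * L / 2) / (s - t))\<^sup>2
      = (norm ((?g s - ?g t) /\<^sub>R (s - t)))\<^sup>2"
      by (simp add: power_divide)
  qed
  ultimately have "((\<lambda>s. (norm ((?g s - ?g t) /\<^sub>R (s - t)))\<^sup>2) \<longlongrightarrow> 4 * Im (?g t) * Im (?g t) * (L / 2)\<^sup>2) ?F"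
    by (rule Lim_transform_eventually)
  from tendsto_unique[OF nb tendsto_power[OF lim] this]
  have "(norm D)\<^sup>2 = (L * Im (?g t))\<^sup>2" by (simp add: power2_eq_square)
  then show ?thesis
    using hyp_len_pos Im_hyp_segment_pos[OF t] by (simp add: power2_eq_iff_nonneg)
qed

end

subsection \<open>The metrics and their geodesics\<close>

lemma const_in_piecewise_C1_paths:
  fixes z :: "'a::real_normed_vector"
  shows "z \<in> M \<Longrightarrow> (\<lambda>_. z) \<in> piecewise_C1_paths M z z"
  \<comment> \<open>A single piece suffices: \<open>n = 1\<close>, with the embedding
    \<open>real\<close> as partition, since it sends the indices 0 and 1 to the numbers 0 and
    1.\<close>
  unfolding piecewise_C1_paths_def piecewise_C1_path_def
  by (auto simp: path_image_def pathstart_def pathfinish_def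
      intro!: exI[of _ "1::nat"] exI[of _ real] exI[of _ "\<lambda>_::real. 0::'a"])

text \<open>As the speed is \<open>L * Im (g t)\<close> with \<open>L = hyp_len z w\<close>, the
  first summand of the weak norm is the constant \<open>L / 2\<close>. The second is
  \<open>(1 - p) / 2\<close> times the derivative of \<open>ln (Im (g t))\<close> and integrates to
  a boundary term.\<close>

lemma hyp_segment_path:
  assumes z: "Im z > 0" and w: "Im w > 0" and zw: "z \<noteq> w"
  shows "hyp_segment z w \<in> piecewise_C1_paths upper_half_plane z w"
    and "finsler_length (delta_p_norm p) (hyp_segment z w) =
           hyp_len z w / 2 + (1 - p) / 2 * ln (Im w / Im z)"
proof -
  let ?g = "hyp_segment z w"
  obtain D where D: "continuous_on {0..1} D"
    and gD: "\<And>t. t \<in> {0..1} \<Longrightarrow> (?g has_vector_derivative D t) (at t within {0..1})"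
    using hyp_segment_C1[OF z w zw] by blast
  have M: "?g t \<in> upper_half_plane" if "t \<in> {0..1}" for t
    using Im_hyp_segment_pos[OF z w zw that] by (simp add: upper_half_plane_def)
  show "?g \<in> piecewise_C1_paths upper_half_plane z w"
    unfolding piecewise_C1_paths_def piecewise_C1_path_def
    using D gD M hyp_segment_0[OF z w zw] hyp_segment_1[OF z w zw]
    by (auto simp: path_image_def pathstart_def pathfinish_def
        intro!: exI[of _ "1::nat"] exI[of _ real] exI[of _ D])
  have "finsler_length (delta_p_norm p) ?g = integral {0..1} (\<lambda>t. delta_p_norm p (?g t) (D t))"
    unfolding finsler_length_def
    by (rule integral_unique[OF finsler_integrand_has_integral_piece(1)[OF _ continuous_on_delta_p_norm D gD M]])
      simp_all
  also have "\<dots> = hyp_len z w / 2 + (1 - p) / 2 * ln (Im w / Im z)"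
  proof (rule integral_unique)
    have "((\<lambda>t. Im (D t) / Im (?g t)) has_integral (ln (Im (?g 1)) - ln (Im (?g 0)))) {0..1}"
    proof (rule has_integral_derivative_along_path[where \<Phi> = "\<lambda>\<zeta>. ln (Im \<zeta>)" and \<Phi>' = "\<lambda>\<zeta> v. Im v / Im \<zeta>"])
      show "((\<lambda>\<zeta>. ln (Im \<zeta>)) has_derivative (\<lambda>v. Im v / Im (?g t))) (at (?g t))"
        if "t \<in> {0..1}" for t
        using Im_hyp_segment_pos[OF z w zw that] by (auto intro!: derivative_eq_intros simp: divide_simps)
    qed (use gD in auto)
    then have "((\<lambda>t. hyp_len z w / 2 + (1 - p) / 2 * (Im (D t) / Im (?g t))) has_integral
        (hyp_len z w / 2 + (1 - p) / 2 * ln (Im w / Im z))) {0..1}"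
      using z w has_integral_const_real[of "hyp_len z w / 2" 0 1]
      by (intro has_integral_add has_integral_mult_right)
        (simp_all add: hyp_segment_0[OF z w zw] hyp_segment_1[OF z w zw] ln_div)
    then show "((\<lambda>t. delta_p_norm p (?g t) (D t)) has_integral
        (hyp_len z w / 2 + (1 - p) / 2 * ln (Im w / Im z))) {0..1}"
    proof (rule has_integral_eq[rotated])
      fix t :: real assume t: "t \<in> {0..1}"
      show "hyp_len z w / 2 + (1 - p) / 2 * (Im (D t) / Im (?g t)) = delta_p_norm p (?g t) (D t)"
        using Im_hyp_segment_pos[OF z w zw t] norm_derivative_hyp_segment[OF z w zw t gD[OF t]]
        by (simp add: delta_p_norm_def add_divide_distrib)
    qed
  qed
  finally show "finsler_length (delta_p_norm p) ?g = hyp_len z w / 2 + (1 - p) / 2 * ln (Im w / Im z)" .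
qed

lemma hyp_len_refl [simp]: "hyp_len z z = 0"
  by (simp add: hyp_len_def hyp_cosh_def)

lemma exists_path_of_length:
  assumes z: "Im z > 0" and w: "Im w > 0"
  shows "\<exists>g\<in>piecewise_C1_paths upper_half_plane z w.
    finsler_length (delta_p_norm p) g = hyp_len z w / 2 + (1 - p) / 2 * ln (Im w / Im z)"
proof (cases "z = w")
  case True
  with z have "finsler_length (delta_p_norm p) (\<lambda>_. z) = hyp_len z w / 2 + (1 - p) / 2 * ln (Im w / Im z)"
    by (simp add: finsler_length_def delta_p_norm_def)
  with True z show ?thesis
    using const_in_piecewise_C1_paths[of z upper_half_plane] by (auto simp: upper_half_plane_def)
next
  case False
  with hyp_segment_path[OF z w] show ?thesis by blast
qed

section \<open>The supremum of the potential differences\<close>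

text \<open>The length of any path bounds the increments of the potentials from above, so a path of
  the stated length proves the inequality without further computation.\<close>

lemma potential_difference_le:
  assumes "Im z > 0" "Im w > 0"
  shows "potential p x w - potential p x z \<le> hyp_len z w / 2 + (1 - p) / 2 * ln (Im w / Im z)"
  using exists_path_of_length[OF assms] finsler_length_delta_p_ge by metis

lemma quadratic_nonneg_imp:
  fixes a b c :: real
  assumes nonneg: "\<And>u. 0 \<le> a * u\<^sup>2 + 2 * b * u + c"
  shows "a \<ge> 0" "c \<ge> 0" "b\<^sup>2 \<le> a * c"
proof -
  show c: "c \<ge> 0" using nonneg[of 0] by simp
  show a: "a \<ge> 0"
  proof (rule ccontr)
    assume "\<not> a \<ge> 0"
    then have a: "a < 0" by simp
    \<comment> \<open>Chosen so that \<open>u \<ge> 1\<close> and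
      \<open>a * u = a - (c + 1)\<close>. Then \<open>a * u^2 + c \<le> a - 1 < 0\<close>, while
      adding the values at \<open>u\<close> and \<open>- u\<close> cancels the linear term.\<close>
    define u where "u = (c + 1) / (- a) + 1"
    have "u \<ge> 1" using a c by (simp add: u_def divide_nonneg_neg)
    then have "u \<le> u\<^sup>2" by (simp add: power2_eq_square)
    then have "a * u\<^sup>2 \<le> a * u" using a by simp
    also have "a * u = a - (c + 1)" using a by (simp add: u_def field_simps)
    finally show False using nonneg[of u] nonneg[of "- u"] a by simp
  qed
  show "b\<^sup>2 \<le> a * c"
  proof (cases "a = 0")
    case True
    have "b = 0"
    proof (rule ccontr)
      assume "b \<noteq> 0"
      \<comment> \<open>At this argument the remaining linear function takes the value -1.\<close>
      then show False using nonneg[of "- (c + 1) / (2 * b)"] True by (simp add: field_simps)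
    qed
    with True show ?thesis by simp
  next
    case False
    with a have a: "a > 0" by simp
    have "a * (- b / a)\<^sup>2 + 2 * b * (- b / a) + c = c - b\<^sup>2 / a"
      using a by (simp add: field_simps power2_eq_square)
    with nonneg[of "- b / a"] have "b\<^sup>2 / a \<le> c" by simp
    with a show ?thesis by (simp add: field_simps)
  qed
qed

text \<open>In \<open>u = x - Re z\<close> the bound says that a quadratic is nonnegative. Its
  discriminant condition factors as \<open>(m - r * E) * (m - r / E) \<ge> 0\<close>, so
  \<open>m\<close> does not lie strictly between the two roots. The leading coefficient gives
  \<open>m \<ge> 1\<close>, and 1 itself lies between the roots, which leaves
  \<open>m \<ge> r * E\<close>.\<close>

lemma hyp_len_le_of_ratio_bound:
  assumes z: "Im z > 0" and w: "Im w > 0"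
    and bound: "\<And>x. (Re w - x)\<^sup>2 + (Im w)\<^sup>2 \<le> m * ((Re z - x)\<^sup>2 + (Im z)\<^sup>2)"
  shows "Im w / Im z * exp (hyp_len z w) \<le> m"
proof (rule ccontr)
  define d y y' where "d = Re w - Re z" and "y = Im z" and "y' = Im w"
  define r E where "r = y' / y" and "E = exp (hyp_len z w)"
  have y: "y > 0" "y' > 0" using z w by (auto simp: y_def y'_def)
  have r: "r > 0" using y by (simp add: r_def)
  have E: "E \<ge> 1" using hyp_len_nonneg[OF z w] by (simp add: E_def)
  assume "\<not> Im w / Im z * exp (hyp_len z w) \<le> m"
  then have less: "m < r * E" by (simp add: r_def E_def y_def y'_def)
  have nonneg: "0 \<le> (m - 1) * u\<^sup>2 + 2 * d * u + (m * y\<^sup>2 - d\<^sup>2 - y'\<^sup>2)" for u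
    using bound[of "Re z + u"] by (simp add: d_def y_def y'_def power2_eq_square algebra_simps)
  note quad = quadratic_nonneg_imp[of "m - 1" d "m * y\<^sup>2 - d\<^sup>2 - y'\<^sup>2", OF nonneg]
  have "E + inverse E = 2 * hyp_cosh z w"
    by (simp add: E_def cosh_hyp_len[OF z w, symmetric] cosh_field_def exp_minus)
  also have "\<dots> = (d\<^sup>2 + y\<^sup>2 + y'\<^sup>2) / (y * y')"
    using z w by (simp add: hyp_cosh_eq d_def y_def y'_def power2_commute[of "Re z"])
      (simp add: field_simps)
  finally have rE: "y\<^sup>2 * r * (E + inverse E) = d\<^sup>2 + y\<^sup>2 + y'\<^sup>2"
    using y by (simp add: r_def field_simps power2_eq_square)
  have factor: "y\<^sup>2 * ((k - r * E) * (k - r * inverse E)) = y\<^sup>2 * k\<^sup>2 - k * (d\<^sup>2 + y\<^sup>2 + y'\<^sup>2) + y'\<^sup>2" for k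
  proof -
    have "y\<^sup>2 * ((k - r * E) * (k - r * inverse E))
        = y\<^sup>2 * k\<^sup>2 - k * (y\<^sup>2 * r * (E + inverse E)) + y\<^sup>2 * r\<^sup>2 * (E * inverse E)"
      by (simp add: power2_eq_square algebra_simps)
    also have "\<dots> = y\<^sup>2 * k\<^sup>2 - k * (d\<^sup>2 + y\<^sup>2 + y'\<^sup>2) + y'\<^sup>2"
      using E y by (simp add: rE) (simp add: r_def power_divide)
    finally show ?thesis .
  qed
  have "0 \<le> y\<^sup>2 * ((m - r * E) * (m - r * inverse E))"
    unfolding factor using quad(3) by (simp add: power2_eq_square algebra_simps)
  then have "m \<le> r * inverse E"
    using y less by (simp add: zero_le_mult_iff)
  \<comment> \<open>The value of the factored polynomial at 1 is nonpositive, which places 1 between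
    the roots.\<close>
  have "y\<^sup>2 * ((1 - r * E) * (1 - r * inverse E)) = - d\<^sup>2"
    unfolding factor by simp
  then have "y\<^sup>2 * ((1 - r * E) * (1 - r * inverse E)) \<le> 0" by simp
  then have "r * inverse E \<le> 1"
    using y less quad(1) by (simp add: mult_le_0_iff)
  with \<open>m \<le> r * inverse E\<close> quad(1) have m: "m = 1" "r * inverse E = 1" by auto
  \<comment> \<open>Only the case remains where \<open>m = 1\<close> is the smaller root and the
    quadratic has no square term; the sign of its constant term excludes it, since it forces
    \<open>r \<le> 1\<close> and hence \<open>E = 1\<close>.\<close>
  then have "r = E" using E by (simp add: field_simps)
  have "y'\<^sup>2 \<le> y\<^sup>2" using quad(2) zero_le_power2[of d] unfolding m(1) by linarith
  then have "y' \<le> y" using y by (simp add: power2_le_iff_abs_le)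
  then have "r \<le> 1" using y by (simp add: r_def)
  with \<open>r = E\<close> E m less show False by simp
qed

lemma hyp_len_le_of_potential_bound:
  assumes z: "Im z > 0" and w: "Im w > 0"
    and bound: "\<And>x. potential p x w - potential p x z \<le> l"
  shows "hyp_len z w / 2 + (1 - p) / 2 * ln (Im w / Im z) \<le> l"
proof -
  \<comment> \<open>This constant arises by doubling the inequality for the potentials, moving the
    heights to the right-hand side and exponentiating.\<close>
  define m where "m = exp (2 * l + p * ln (Im w / Im z))"
  have "(Re w - x)\<^sup>2 + (Im w)\<^sup>2 \<le> m * ((Re z - x)\<^sup>2 + (Im z)\<^sup>2)" for x
  proof -
    define A B where "A = (Re w - x)\<^sup>2 + (Im w)\<^sup>2" and "B = (Re z - x)\<^sup>2 + (Im z)\<^sup>2"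
    have pos: "A > 0" "B > 0" using z w by (auto simp: A_def B_def add_nonneg_pos)
    have "ln A \<le> 2 * l + p * ln (Im w / Im z) + ln B"
      using bound[of x] z w
      by (simp add: potential_def ln_div right_diff_distrib diff_divide_distrib flip: A_def B_def)
    then have "exp (ln A) \<le> exp (2 * l + p * ln (Im w / Im z) + ln B)" by simp
    then show ?thesis using pos by (simp add: m_def exp_add flip: A_def B_def)
  qed
  from hyp_len_le_of_ratio_bound[OF z w this]
  have "exp (ln (Im w / Im z) + hyp_len z w) \<le> m"
    using z w by (simp add: exp_add)
  then have "ln (Im w / Im z) + hyp_len z w \<le> 2 * l + p * ln (Im w / Im z)"
    by (simp add: m_def)
  then show ?thesis by (simp add: field_simps)
qed

text \<open>The closed form is an upper bound by \<open>potential_difference_le\<close>. It is the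
  least one because \<open>hyp_len_le_of_potential_bound\<close> applies to the logarithm of any
  other upper bound.\<close>

lemma delta_p_eq:
  assumes z: "Im z > 0" and w: "Im w > 0"
  shows "delta_p p z w = hyp_len z w / 2 + (1 - p) / 2 * ln (Im w / Im z)" (is "_ = ?K")
proof -
  have "(SUP x. exp (potential p x w - potential p x z)) = exp ?K"
  proof (rule cSup_eq_non_empty)
    fix B assume B: "\<And>a. a \<in> range (\<lambda>x. exp (potential p x w - potential p x z)) \<Longrightarrow> a \<le> B"
    have "B > 0" using B[of "exp (potential p 0 w - potential p 0 z)"] exp_gt_zero less_le_trans by blast
    have "?K \<le> ln B"
    proof (rule hyp_len_le_of_potential_bound[OF z w])
      show "potential p x w - potential p x z \<le> ln B" for x
        using B[of "exp (potential p x w - potential p x z)"] \<open>B > 0\<close> by (simp add: ln_ge_iff)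
    qed
    then show "exp ?K \<le> B" using \<open>B > 0\<close> by (simp add: ln_ge_iff)
  qed (use potential_difference_le[OF z w] in auto)
  then show ?thesis
    unfolding delta_p_def exp_potential_difference[OF z w] by simp
qed

section \<open>The infimum of lengths and the hyperbolic distance\<close>

text \<open>The infimum is attained. Every path length bounds the potential differences for all
  \<open>x\<close> at once, and hence also their supremum.\<close>

lemma INF_finsler_length_delta_p_norm:
  assumes z: "Im z > 0" and w: "Im w > 0"
  shows "(INF g\<in>piecewise_C1_paths upper_half_plane z w. finsler_length (delta_p_norm p) g) =
    hyp_len z w / 2 + (1 - p) / 2 * ln (Im w / Im z)"
proof (rule cInf_eq_minimum)
  show "hyp_len z w / 2 + (1 - p) / 2 * ln (Im w / Im z)
      \<in> finsler_length (delta_p_norm p) ` piecewise_C1_paths upper_half_plane z w"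
    using exists_path_of_length[OF z w, of p] by force
qed (use finsler_length_delta_p_ge hyp_len_le_of_potential_bound[OF z w] in blast)

lemma hyp_dist_eq:
  assumes "Im z > 0" "Im w > 0"
  shows "hyp_dist z w = hyp_len z w / 2"
proof -
  have "(\<lambda>\<zeta> v. sqrt ((Re v)\<^sup>2 + (Im v)\<^sup>2) / (2 * Im \<zeta>)) = delta_p_norm 1"
    by (simp add: fun_eq_iff delta_p_norm_def cmod_def)
  then show ?thesis
    using INF_finsler_length_delta_p_norm[OF assms, of 1] by (simp add: hyp_dist_def)
qed

text \<open>Increments of \<open>potential 1 x\<close> add up along \<open>z\<close>,
  \<open>w\<close>, \<open>u\<close>, and for \<open>p = 1\<close> their supremum over
  \<open>x\<close> is half of \<open>hyp_len\<close>.\<close>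

lemma hyp_len_triangle:
  assumes z: "Im z > 0" and w: "Im w > 0" and u: "Im u > 0"
  shows "hyp_len z u \<le> hyp_len z w + hyp_len w u"
proof -
  have "hyp_len z u / 2 + (1 - 1) / 2 * ln (Im u / Im z) \<le> hyp_len z w / 2 + hyp_len w u / 2"
  proof (rule hyp_len_le_of_potential_bound[OF z u])
    show "potential 1 x u - potential 1 x z \<le> hyp_len z w / 2 + hyp_len w u / 2" for x
      using potential_difference_le[OF z w, of 1 x] potential_difference_le[OF w u, of 1 x] by simp
  qed
  then show ?thesis by simp
qed

section \<open>Points between two given points\<close>

text \<open>Otherwise the midpoint \<open>N\<close> of \<open>P\<close> and \<open>Q\<close> would
  be strictly closer than \<open>P\<close> to both \<open>z\<close> and \<open>w\<close>, because
  its \<open>hyp_cosh\<close> is that of \<open>P\<close> divided by a number greater than 1. This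
  contradicts the triangle inequality.\<close>

lemma hyp_len_between_unique:
  assumes pos: "Im z > 0" "Im w > 0" "Im P > 0" "Im Q > 0"
    and zP: "hyp_len z Q = hyp_len z P" and Pw: "hyp_len Q w = hyp_len P w"
    and between: "hyp_len z w = hyp_len z P + hyp_len P w"
  shows "P = Q"
proof (rule ccontr)
  assume PQ: "P \<noteq> Q"
  define N where "N = hyp_segment P Q (1/2)"
  have N: "Im N > 0" unfolding N_def by (rule Im_hyp_segment_pos[OF pos(3,4) PQ]) simp
  have "hyp_len P Q / 2 > 0" using hyp_len_pos[OF pos(3,4) PQ] by simp
  then have c: "cosh (hyp_len P Q / 2) > 1"
    using cosh_real_nonneg_less_iff[of 0 "hyp_len P Q / 2"] by simp
  have less: "hyp_len N u < hyp_len P u" if u: "Im u > 0" and eq: "hyp_len Q u = hyp_len P u" for u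
  proof -
    have "hyp_cosh Q u = hyp_cosh P u"
      using eq cosh_hyp_len[OF pos(3) u] cosh_hyp_len[OF pos(4) u] by metis
    then have "hyp_cosh N u = hyp_cosh P u / cosh (hyp_len P Q / 2)"
      using hyp_cosh_hyp_segment_midpoint[OF pos(3,4) PQ u] by (simp add: N_def)
    also have "\<dots> < hyp_cosh P u"
      using c hyp_cosh_ge_1[OF pos(3) u] by (simp add: field_simps)
    finally have "cosh (hyp_len N u) < cosh (hyp_len P u)"
      by (simp add: cosh_hyp_len N u pos)
    then show ?thesis
      using cosh_real_nonneg_less_iff hyp_len_nonneg N u pos by blast
  qed
  have "hyp_len z w \<le> hyp_len N z + hyp_len N w"
    using hyp_len_triangle[OF pos(1) N pos(2)] by (simp add: hyp_len_commute[of z N])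
  also have "\<dots> < hyp_len P z + hyp_len P w"
    using less[OF pos(1)] less[OF pos(2)] zP Pw
    by (simp add: hyp_len_commute[of _ z])
  finally show False using between by (simp add: hyp_len_commute[of P z])
qed

text \<open>The logarithmic terms in \<open>delta_p_eq\<close> telescope, so they disappear from the
  defect. The triangle inequality and the geodesic condition thus pass between
  \<open>delta_p\<close> and \<open>hyp_len\<close>.\<close>

lemma delta_p_triangle_defect:
  assumes "Im z > 0" "Im w > 0" "Im u > 0"
  shows "delta_p p z w + delta_p p w u - delta_p p z u = (hyp_len z w + hyp_len w u - hyp_len z u) / 2"
proof -
  have "k * ln (Im u / Im z) = k * ln (Im w / Im z) + k * ln (Im u / Im w)" for k
    using assms by (simp add: ln_div right_diff_distrib)
  then show ?thesis
    unfolding delta_p_eq[OF assms(1,2)] delta_p_eq[OF assms(2,3)] delta_p_eq[OF assms(1,3)]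
    by (simp add: add_divide_distrib diff_divide_distrib)
qed

lemma delta_p_additive_iff:
  assumes "Im z > 0" "Im w > 0" "Im u > 0"
  shows "delta_p p z u = delta_p p z w + delta_p p w u \<longleftrightarrow> hyp_len z u = hyp_len z w + hyp_len w u"
  using delta_p_triangle_defect[OF assms, of p] by auto

section \<open>The weak Finsler structure\<close>

lemma open_upper_half_plane: "open upper_half_plane"
  unfolding upper_half_plane_def by (rule open_halfspace_Im_gt)

lemma connected_upper_half_plane: "connected upper_half_plane"
  unfolding upper_half_plane_def by (rule convex_connected[OF convex_halfspace_Im_gt])

lemma weak_metric_on_delta_p:
  assumes p: "p \<in> {0..1}"
  shows "weak_metric_on upper_half_plane (delta_p p)"
  unfolding weak_metric_on_def
proof (intro conjI ballI)
  fix z w assume zw: "z \<in> upper_half_plane" "w \<in> upper_half_plane"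
  then have pos: "Im z > 0" "Im w > 0" by (auto simp: upper_half_plane_def)
  have "\<bar>(1 - p) * ln (Im w / Im z)\<bar> \<le> 1 * \<bar>ln (Im w / Im z)\<bar>"
    unfolding abs_mult using p by (intro mult_right_mono) auto
  also have "\<dots> \<le> hyp_len z w" using hyp_len_ge_abs_ln[OF pos] by simp
  finally show "delta_p p z w \<ge> 0" by (simp add: delta_p_eq pos)
  show "delta_p p z z = 0" using pos by (simp add: delta_p_eq)
  fix u assume "u \<in> upper_half_plane"
  then have u: "Im u > 0" by (simp add: upper_half_plane_def)
  show "delta_p p z u \<le> delta_p p z w + delta_p p w u"
    using hyp_len_triangle[OF pos u] delta_p_triangle_defect[OF pos u, of p] by simp
qed

lemma weak_norm_delta_p_norm:
  assumes p: "p \<in> {0..1}" and z: "Im \<zeta> > 0"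
  shows "weak_norm (delta_p_norm p \<zeta>)"
  unfolding weak_norm_def
proof (intro conjI allI)
  fix v w
  have "\<bar>(1 - p) * Im v\<bar> \<le> 1 * \<bar>Im v\<bar>"
    unfolding abs_mult using p by (intro mult_right_mono) auto
  also have "\<dots> \<le> cmod v" using abs_Im_le_cmod[of v] by simp
  finally show "delta_p_norm p \<zeta> v \<ge> 0" using z by (simp add: delta_p_norm_def)
  show "delta_p_norm p \<zeta> 0 = 0" by (simp add: delta_p_norm_def)
  show "delta_p_norm p \<zeta> (v + w) \<le> delta_p_norm p \<zeta> v + delta_p_norm p \<zeta> w"
    using z norm_triangle_ineq[of v w]
    by (simp add: delta_p_norm_def divide_right_mono algebra_simps flip: add_divide_distrib)
qed

lemma weak_finsler_metric_on_delta_p: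
  assumes "p \<in> {0..1}"
  shows "weak_finsler_metric_on upper_half_plane (delta_p p) (delta_p_norm p)"
  unfolding weak_finsler_metric_on_def
  using open_upper_half_plane connected_upper_half_plane weak_metric_on_delta_p[OF assms]
    weak_norm_delta_p_norm[OF assms] continuous_on_delta_p_norm
  by (auto simp: upper_half_plane_def delta_p_eq
      INF_finsler_length_delta_p_norm[unfolded upper_half_plane_def])

section \<open>Existence and uniqueness of geodesics\<close>

text \<open>Keeps the uniqueness claim, which speaks of all hyperbolic geodesics from
  \<open>z\<close> to \<open>w\<close>, from being vacuous.\<close>

lemma hyperbolic_geodesic_exists:
  assumes z: "Im z > 0" and w: "Im w > 0"
  shows "\<exists>g. hyperbolic_geodesic z w g"
proof (cases "z = w")
  case True
  with z have "hyperbolic_geodesic z w (\<lambda>_. z)"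
    by (auto simp: hyperbolic_geodesic_def path_def path_image_def pathstart_def pathfinish_def
        upper_half_plane_def hyp_dist_eq)
  then show ?thesis by blast
next
  case False
  let ?g = "hyp_segment z w"
  obtain D where "\<And>t. t \<in> {0..1} \<Longrightarrow> (?g has_vector_derivative D t) (at t within {0..1})"
    using hyp_segment_C1[OF z w False] by blast
  then have "path ?g"
    unfolding path_def continuous_on_eq_continuous_within
    using has_vector_derivative_continuous by blast
  moreover have pos: "Im (?g t) > 0" if "t \<in> {0..1}" for t
    using Im_hyp_segment_pos[OF z w False that] .
  moreover have "hyp_dist (?g s) (?g t) = \<bar>s - t\<bar> * hyp_dist z w" if "s \<in> {0..1}" "t \<in> {0..1}" for s t
    using hyp_len_hyp_segment[OF z w False that] by (simp add: hyp_dist_eq pos[OF that(1)] pos[OF that(2)] z w)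
  ultimately have "hyperbolic_geodesic z w ?g"
    using hyp_segment_0[OF z w False] hyp_segment_1[OF z w False]
    by (auto simp: hyperbolic_geodesic_def path_image_def pathstart_def pathfinish_def upper_half_plane_def)
  then show ?thesis by blast
qed

lemma weak_geodesic_hyp_len:
  assumes "weak_geodesic upper_half_plane (delta_p p) z w c"
  shows "\<And>t. t \<in> {0..1} \<Longrightarrow> Im (c t) > 0"
    and "\<And>r s t. 0 \<le> r \<Longrightarrow> r \<le> s \<Longrightarrow> s \<le> t \<Longrightarrow> t \<le> 1 \<Longrightarrow>
      hyp_len (c r) (c t) = hyp_len (c r) (c s) + hyp_len (c s) (c t)"
proof -
  show pos: "Im (c t) > 0" if "t \<in> {0..1}" for t
    using assms that by (simp add: weak_geodesic_def path_image_def upper_half_plane_def image_subset_iff)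
  show "hyp_len (c r) (c t) = hyp_len (c r) (c s) + hyp_len (c s) (c t)"
    if "0 \<le> r" "r \<le> s" "s \<le> t" "t \<le> 1" for r s t
    using assms that delta_p_additive_iff[of "c r" "c s" "c t" p] pos[of r] pos[of s] pos[of t]
    by (simp add: weak_geodesic_def)
qed

lemma continuous_on_hyp_len:
  fixes S :: "real set"
  assumes "continuous_on S c" "\<And>t. t \<in> S \<Longrightarrow> Im (c t) > 0" "Im z > 0"
  shows "continuous_on S (\<lambda>t. hyp_len z (c t))"
proof -
  have "continuous_on S (\<lambda>t. hyp_cosh z (c t))"
    unfolding hyp_cosh_def using assms by (intro continuous_intros) fastforce+
  then show ?thesis
    unfolding hyp_len_def by (rule continuous_on_arcosh') (use assms hyp_cosh_ge_1 in auto)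
qed

lemma unique_weak_geodesic_hyperbolic_geodesic:
  assumes z: "Im z > 0" and w: "Im w > 0" and g: "hyperbolic_geodesic z w g"
  shows "unique_weak_geodesic upper_half_plane (delta_p p) z w g"
proof -
  from g have gpath: "path g" "path_image g \<subseteq> upper_half_plane" and g01: "g 0 = z" "g 1 = w"
    by (auto simp: hyperbolic_geodesic_def pathstart_def pathfinish_def)
  then have gpos: "Im (g t) > 0" if "t \<in> {0..1}" for t
    using that by (simp add: path_image_def upper_half_plane_def image_subset_iff)
  have glen: "hyp_len (g s) (g t) = \<bar>s - t\<bar> * hyp_len z w" if "s \<in> {0..1}" "t \<in> {0..1}" for s t
  proof -
    have "hyp_dist (g s) (g t) = \<bar>s - t\<bar> * hyp_dist z w"
      using g that by (simp add: hyperbolic_geodesic_def)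
    then show ?thesis
      by (simp add: hyp_dist_eq z w gpos[OF that(1)] gpos[OF that(2)])
  qed
  have "weak_geodesic upper_half_plane (delta_p p) z w g"
    unfolding weak_geodesic_def
  proof (intro conjI allI impI)
    fix r s t :: real assume "0 \<le> r \<and> r \<le> s \<and> s \<le> t \<and> t \<le> 1"
    then have "r \<in> {0..1}" "s \<in> {0..1}" "t \<in> {0..1}" "r \<le> s" "s \<le> t" by auto
    then show "delta_p p (g r) (g t) = delta_p p (g r) (g s) + delta_p p (g s) (g t)"
      by (simp add: delta_p_additive_iff gpos glen algebra_simps)
  qed (use gpath g01 in \<open>auto simp: pathstart_def pathfinish_def\<close>)
  moreover have "reparametrisation_of g c" if c: "weak_geodesic upper_half_plane (delta_p p) z w c" for c
  proof -
    note cpos = weak_geodesic_hyp_len(1)[OF c] and clen = weak_geodesic_hyp_len(2)[OF c]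
    from c have cont: "continuous_on {0..1} c" and c01: "c 0 = z" "c 1 = w"
      by (auto simp: weak_geodesic_def path_def pathstart_def pathfinish_def)
    show ?thesis
    proof (cases "z = w")
      case True
      \<comment> \<open>Additivity at the parameters 0, \<open>t\<close>, 1 makes two nonnegative
        distances sum to 0, so both paths are constant and the identity serves as
        reparametrisation.\<close>
      have "c t = g t" if t: "t \<in> {0..1}" for t
      proof -
        have "hyp_len z (c t) = 0"
          using clen[of 0 t 1] t hyp_len_nonneg[OF z cpos[OF t]] hyp_len_nonneg[OF cpos[OF t] w] True
          by (simp add: c01)
        moreover have "hyp_len z (g t) = 0"
          using glen[of 0 t] t True by (simp add: g01)
        ultimately show ?thesis
          using hyp_len_eq_0_iff[OF z cpos[OF t]] hyp_len_eq_0_iff[OF z gpos[OF t]] by simp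
      qed
      then show ?thesis
        unfolding reparametrisation_of_def
        by (intro exI[of _ "\<lambda>t. t"]) (auto intro: mono_onI)
    next
      case False
      define L where "L = hyp_len z w"
      have L: "L > 0" using hyp_len_pos[OF z w False] by (simp add: L_def)
      \<comment> \<open>Forced by the distance from \<open>z\<close>: the point
        \<open>g (\<phi> t)\<close> lies at distance \<open>\<phi> t * L\<close> from
        \<open>z\<close>, and this has to be the distance of \<open>c t\<close>.\<close>
      define \<phi> where "\<phi> t = hyp_len z (c t) / L" for t
      have "continuous_on {0..1} \<phi>"
        unfolding \<phi>_def using L z by (intro continuous_intros continuous_on_hyp_len cont cpos) auto
      moreover have mono: "mono_on {0..1} \<phi>"
      proof (rule mono_onI)
        fix s t :: real assume st: "s \<in> {0..1}" "t \<in> {0..1}" "s \<le> t"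
        then have "hyp_len z (c s) \<le> hyp_len z (c t)"
          using clen[of 0 s t] hyp_len_nonneg[OF cpos[of s] cpos[of t]] by (simp add: c01)
        then show "\<phi> s \<le> \<phi> t" using L by (simp add: \<phi>_def divide_right_mono)
      qed
      moreover have \<phi>01: "\<phi> 0 = 0" "\<phi> 1 = 1" using L by (simp_all add: \<phi>_def c01 L_def)
      moreover have "c t = g (\<phi> t)" if t: "t \<in> {0..1}" for t
      proof -
        have \<phi>: "\<phi> t \<in> {0..1}"
          using mono_onD[OF mono, of 0 t] mono_onD[OF mono, of t 1] t \<phi>01 by auto
        have zc: "hyp_len z (c t) = \<phi> t * L" using L by (simp add: \<phi>_def)
        have sum: "L = hyp_len z (c t) + hyp_len (c t) w"
          using clen[of 0 t 1] t by (simp add: c01 L_def)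
        have "hyp_len z (g (\<phi> t)) = hyp_len z (c t)"
          using glen[of 0 "\<phi> t"] \<phi> by (simp add: g01 zc L_def)
        moreover have "hyp_len (g (\<phi> t)) w = hyp_len (c t) w"
          using glen[of "\<phi> t" 1] \<phi> sum zc by (simp add: g01 L_def algebra_simps)
        ultimately show ?thesis
          using hyp_len_between_unique[OF z w cpos[OF t] gpos[OF \<phi>]] sum by (simp add: L_def)
      qed
      ultimately show ?thesis
        unfolding reparametrisation_of_def by blast
    qed
  qed
  ultimately show ?thesis
    by (simp add: unique_weak_geodesic_def)
qed

theorem mainTheorem4:
  shows "(\<forall>p\<in>{0..1}.
            weak_finsler_metric_on upper_half_plane (delta_p p) (delta_p_norm p) \<and>
            (\<forall>\<zeta>1\<in>upper_half_plane. \<forall>\<zeta>2\<in>upper_half_plane.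
               (\<exists>g. hyperbolic_geodesic \<zeta>1 \<zeta>2 g) \<and>
               (\<forall>g. hyperbolic_geodesic \<zeta>1 \<zeta>2 g \<longrightarrow>
                  unique_weak_geodesic upper_half_plane (delta_p p) \<zeta>1 \<zeta>2 g))) \<and>
         (\<forall>\<zeta>1\<in>upper_half_plane. \<forall>\<zeta>2\<in>upper_half_plane.
            continuous_on {0..1} (\<lambda>p. delta_p p \<zeta>1 \<zeta>2) \<and>
            delta_p 0 \<zeta>1 \<zeta>2 = delta \<zeta>1 \<zeta>2 \<and>
            delta_p 1 \<zeta>1 \<zeta>2 = hyp_dist \<zeta>1 \<zeta>2)"
proof (rule conjI; intro ballI)
  fix p :: real assume p: "p \<in> {0..1}"
  show "weak_finsler_metric_on upper_half_plane (delta_p p) (delta_p_norm p) \<and>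
      (\<forall>\<zeta>1\<in>upper_half_plane. \<forall>\<zeta>2\<in>upper_half_plane.
         (\<exists>g. hyperbolic_geodesic \<zeta>1 \<zeta>2 g) \<and>
         (\<forall>g. hyperbolic_geodesic \<zeta>1 \<zeta>2 g \<longrightarrow>
            unique_weak_geodesic upper_half_plane (delta_p p) \<zeta>1 \<zeta>2 g))"
    using weak_finsler_metric_on_delta_p[OF p] hyperbolic_geodesic_exists
      unique_weak_geodesic_hyperbolic_geodesic[of _ _ _ p]
    by (simp add: upper_half_plane_def)
next
  fix z w assume "z \<in> upper_half_plane" "w \<in> upper_half_plane"
  then have pos: "Im z > 0" "Im w > 0" by (auto simp: upper_half_plane_def)
  have "continuous_on {0..1} (\<lambda>p. delta_p p z w)"
    unfolding delta_p_eq[OF pos] by (intro continuous_intros) auto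
  \<comment> \<open>Both heights are positive, so their powers with exponent 0 equal 1.\<close>
  moreover have "delta_p 0 z w = delta z w"
    using pos by (simp add: delta_p_def delta_def)
  moreover have "delta_p 1 z w = hyp_dist z w"
    using pos by (simp add: delta_p_eq hyp_dist_eq)
  ultimately show "continuous_on {0..1} (\<lambda>p. delta_p p z w) \<and>
      delta_p 0 z w = delta z w \<and> delta_p 1 z w = hyp_dist z w" by blast
qed

end
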